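(* Let $P$ be a cubical $d$-polytope with face vector $(f_0,\ldots,f_{d-1})$. Then (i) $f_0<f_1<\cdots<f_{\lfloor d/3\rfloor-1}\le f_{\lfloor d/3\rfloor}$, and (ii) $f_{\lfloor 2d/3\rfloor}>f_{\lfloor 2d/3\rfloor+1}>\cdots>f_{d-1}$.
   Context: A $d$-polytope is cubical if every facet is combinatorially equivalent to the $(d-1)$-cube $[0,1]^{d-1}$ (equivalently, all proper faces are combinatorially cubes). Its face vector is $(f_0,\ldots,f_{d-1})$, where $f_i$ is the number of $i$-dimensional faces. *)

theory Defs
  imports "HOL-Analysis.Analysis"
begin

(* The library's face_of counts both the empty set and S itself as faces of S. *)
definition face_lattice :: "'a::euclidean_space set \<Rightarrow> 'a set set"
  where "face_lattice S = {F. F face_of S}"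

definition combinatorially_equivalent ::
    "'a::euclidean_space set \<Rightarrow> 'b::euclidean_space set \<Rightarrow> bool"
  where "combinatorially_equivalent S T \<longleftrightarrow>
    (\<exists>\<phi>. bij_betw \<phi> (face_lattice S) (face_lattice T) \<and>
         (\<forall>F\<in>face_lattice S. \<forall>G\<in>face_lattice S. F \<subseteq> G \<longleftrightarrow> \<phi> F \<subseteq> \<phi> G))"

(* For B a set of standard basis vectors, this is the cube [0,1]^B in the coordinate subspace
   spanned by B (the other coordinates are 0); its dimension is card B, and 0 is allowed. *)
definition unit_cube :: "'a::euclidean_space set \<Rightarrow> 'a set"
  where "unit_cube B = cbox 0 (\<Sum>B)"

(* The model (d-1)-cube is taken in the ambient space of P. No generality is lost: a d-polytope
   lives in a space of dimension at least d, and coordinate cubes of equal dimension are congruent.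
   For d = 0 there are no facets, since facet_of requires a nonempty face. *)
definition cubical_polytope :: "nat \<Rightarrow> 'a::euclidean_space set \<Rightarrow> bool"
  where "cubical_polytope d P \<longleftrightarrow>
    polytope P \<and> aff_dim P = int d \<and>
    (\<forall>F. F facet_of P \<longrightarrow>
      (\<exists>B\<subseteq>(Basis :: 'a set). card B = d - 1 \<and> combinatorially_equivalent F (unit_cube B)))"

definition face_number :: "'a::euclidean_space set \<Rightarrow> nat \<Rightarrow> nat"
  where "face_number P i = card {F. F face_of P \<and> aff_dim F = int i}"

end

theory Submission imports Defs
begin

text \<open>
  Fix an interior point \<open>m\<close> and write each facet \<open>w\<close> as the part of \<open>P\<close> where
  \<open>a w \<bullet> (x - m) \<le> 1\<close> is tight; the \<open>a w\<close> are the vertices of the polar polytope. A generic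
  direction \<open>u\<close> orders the facets by \<open>u \<bullet> a w\<close>, and every proper face \<open>G\<close> lies in a unique lowest
  facet. By convexity \<open>w\<close> is lowest for \<open>G\<close> iff every ridge of \<open>w\<close> through \<open>G\<close> is ascending, i.e.
  leads to a higher facet. With \<open>n = d - 1\<close>, the faces of dimension \<open>n - k\<close> of the \<open>n\<close>-cube \<open>w\<close> are
  the sets of \<open>k\<close> ridges of \<open>w\<close> without an opposite pair. Each such set extends to \<open>2 ^ (n - k)\<close>
  vertices of \<open>w\<close>, so \<open>2 ^ (n - k) * f (n - k)\<close> is the sum of \<open>p choose k\<close> over all flags of a facet
  \<open>w\<close> and a vertex of \<open>w\<close>, where \<open>p\<close> is the number of ascending ridges of \<open>w\<close> at that vertex.
  Reversing \<open>u\<close> turns \<open>p\<close> into \<open>n - p\<close>. Both parts then follow termwise: the lower one from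
  \<open>2 * (p choose (j + 1)) \<le> p choose j\<close> for large \<open>j\<close>, the upper one, after averaging over \<open>u\<close> and
  \<open>- u\<close>, from the corresponding reverse inequality for the sum over \<open>p\<close> and \<open>n - p\<close>.
\<close>

section \<open>Binomial coefficients and sign sets\<close>

lemma binomial_absorb_int:
  "(int j + 1) * int (m choose Suc j) = (int m - int j) * int (m choose j)"
proof (cases "j \<le> m")
  case True
  have "Suc j * (m choose Suc j) = (m - j) * (m choose j)"
    by (simp only: binomial_absorb_comp binomial_absorption)
  then have "int (Suc j * (m choose Suc j)) = int ((m - j) * (m choose j))" by simp
  then show ?thesis using True by (simp add: of_nat_diff algebra_simps)
qed (simp add: binomial_eq_0)

text \<open>The source of the thirds in the theorem: the sign of \<open>2 * m - 3 * j - 1\<close>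
  decides whether doubling the next coefficient gains or loses. Integers are used because this
  factor may be negative.\<close>

lemma binomial_step_int:
  "(int j + 1) * (2 * int (m choose Suc j) - int (m choose j))
     = (2 * int m - 3 * int j - 1) * int (m choose j)"
  using binomial_absorb_int[of j m] by (simp add: algebra_simps)

lemma two_binomial_Suc_le:
  assumes "2 * n \<le> 3 * j + 1" "p \<le> n"
  shows "2 * (p choose Suc j) \<le> p choose j"
proof -
  have "(2 * int p - 3 * int j - 1) * int (p choose j) \<le> 0"
    using assms by (intro mult_nonpos_nonneg) auto
  then have "(int j + 1) * (2 * int (p choose Suc j) - int (p choose j)) \<le> 0"
    by (simp only: binomial_step_int)
  then have "2 * int (p choose Suc j) - int (p choose j) \<le> 0"
    by (simp add: mult_le_0_iff)
  then show ?thesis by linarith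
qed

text \<open>Only the extreme value \<open>p = n\<close> of the preceding lemma is treated: for
  \<open>p < j\<close> both coefficients vanish and strictness fails.\<close>

lemma two_binomial_Suc_less:
  assumes "2 * n < 3 * j + 1" "j \<le> n"
  shows "2 * (n choose Suc j) < n choose j"
proof -
  have "(2 * int n - 3 * int j - 1) * int (n choose j) < 0"
    using assms by (intro mult_neg_pos) auto
  then have "(int j + 1) * (2 * int (n choose Suc j) - int (n choose j)) < 0"
    by (simp only: binomial_step_int)
  then have "2 * int (n choose Suc j) - int (n choose j) < 0"
    by (simp add: mult_less_0_iff)
  then show ?thesis by linarith
qed

text \<open>The factors \<open>2 * p - 3 * j - 1\<close> and \<open>2 * q - 3 * j - 1\<close> have
  positive sum. If the second is negative, it multiplies the smaller binomial, so replacing that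
  binomial by the larger one only decreases the total.\<close>

lemma binomial_pair_less_aux:
  assumes "q \<le> p" "3 * j + 3 \<le> p + q"
  shows "(p choose j) + (q choose j) < 2 * (p choose Suc j) + 2 * (q choose Suc j)"
proof -
  have pos: "0 < int (p choose j)" using assms by simp
  have le: "int (q choose j) \<le> int (p choose j)" using assms by (simp add: binomial_right_mono)
  have "0 < (2 * int p - 3 * int j - 1) * int (p choose j) + (2 * int q - 3 * int j - 1) * int (q choose j)"
  proof (cases "3 * j + 1 \<le> 2 * q")
    case True
    have "0 < (2 * int p - 3 * int j - 1) * int (p choose j)"
      using assms pos by (intro mult_pos_pos) auto
    moreover have "0 \<le> (2 * int q - 3 * int j - 1) * int (q choose j)"
      using True by (intro mult_nonneg_nonneg) auto
    ultimately show ?thesis by linarith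
  next
    case False
    have "(2 * int q - 3 * int j - 1) * int (p choose j) \<le> (2 * int q - 3 * int j - 1) * int (q choose j)"
      using False le by (intro mult_left_mono_neg) auto
    moreover have "0 < (2 * int p - 3 * int j - 1 + (2 * int q - 3 * int j - 1)) * int (p choose j)"
      using assms pos by (intro mult_pos_pos) auto
    ultimately show ?thesis by (simp add: algebra_simps)
  qed
  then have "0 < (int j + 1) * ((2 * int (p choose Suc j) - int (p choose j)) + (2 * int (q choose Suc j) - int (q choose j)))"
    by (simp only: distrib_left binomial_step_int)
  then have "0 < (2 * int (p choose Suc j) - int (p choose j)) + (2 * int (q choose Suc j) - int (q choose j))"
    by (simp add: zero_less_mult_iff)
  then show ?thesis by linarith
qed

lemma binomial_pair_less:
  assumes "3 * j + 3 \<le> p + q"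
  shows "(p choose j) + (q choose j) < 2 * (p choose Suc j) + 2 * (q choose Suc j)"
  using binomial_pair_less_aux[of q p j] binomial_pair_less_aux[of p q j] assms
  by (cases "q \<le> p") (auto simp: add.commute)

section \<open>Sign sets of cube faces and their extension to corners\<close>

text \<open>A pair \<open>(b, e)\<close> stands for the cube facet where coordinate \<open>b\<close>
  equals \<open>of_bool e\<close>. Injectivity of \<open>fst\<close> excludes opposite facets, so
  these sets index the nonempty faces, the empty set being the whole cube.\<close>

definition partial_signs :: "'b set \<Rightarrow> ('b \<times> bool) set set"
  where "partial_signs B = {T. T \<subseteq> B \<times> UNIV \<and> inj_on fst T}"

definition corner :: "'b set \<Rightarrow> 'b set \<Rightarrow> ('b \<times> bool) set"
  where "corner B X = (\<lambda>b. (b, b \<in> X)) ` B"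

lemma mem_corner [simp]: "(b, e) \<in> corner B X \<longleftrightarrow> b \<in> B \<and> (e \<longleftrightarrow> b \<in> X)"
  by (auto simp: corner_def)

lemma finite_corner [simp]: "finite B \<Longrightarrow> finite (corner B X)"
  by (simp add: corner_def)

lemma card_corner: "card (corner B X) = card B"
  unfolding corner_def by (intro card_image inj_onI) auto

lemma partial_signs_subset: "T \<in> partial_signs B \<Longrightarrow> S \<subseteq> T \<Longrightarrow> S \<in> partial_signs B"
  unfolding partial_signs_def using inj_on_subset by blast

lemma partial_signs_unique: "T \<in> partial_signs B \<Longrightarrow> (b, e) \<in> T \<Longrightarrow> (b, e') \<in> T \<Longrightarrow> e = e'"
  using inj_onD[of fst T "(b, e)" "(b, e')"] by (auto simp: partial_signs_def)

lemma corner_in_partial_signs: "corner B X \<in> partial_signs B"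
  by (auto simp: partial_signs_def corner_def inj_on_def)

lemma finite_partial_signs: "finite B \<Longrightarrow> T \<in> partial_signs B \<Longrightarrow> finite T"
  by (auto simp: partial_signs_def intro: finite_subset)

lemma finite_partial_signs_set: "finite B \<Longrightarrow> finite (partial_signs B)"
  by (rule finite_subset[of _ "Pow (B \<times> UNIV)"]) (auto simp: partial_signs_def)

lemma card_corners_containing:
  assumes B: "finite B" and T: "T \<in> partial_signs B"
  shows "card {X \<in> Pow B. T \<subseteq> corner B X} = 2 ^ (card B - card T)"
proof -
  \<comment> \<open>The coordinates that \<open>T\<close> forces to be 1; a corner containing
    \<open>T\<close> adds to them an arbitrary set of coordinates that \<open>T\<close> leaves
    free.\<close>
  define P where "P = {b. (b, True) \<in> T}"
  have TB: "\<And>b e. (b, e) \<in> T \<Longrightarrow> b \<in> B" using T by (auto simp: partial_signs_def)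
  have "{X \<in> Pow B. T \<subseteq> corner B X} = (\<union>) P ` Pow (B - fst ` T)" (is "?L = ?R")
  proof (intro subset_antisym subsetI)
    fix X assume X: "X \<in> ?L"
    have "P \<subseteq> X" using X by (auto simp: P_def)
    moreover have "X - P \<in> Pow (B - fst ` T)"
    proof -
      have "b \<notin> X - P" if "(b, e) \<in> T" for b e
        using that X by (cases e) (auto simp: P_def)
      then show ?thesis using X by force
    qed
    moreover have "P \<union> (X - P) = X" using \<open>P \<subseteq> X\<close> by blast
    ultimately show "X \<in> ?R" by (metis imageI)
  next
    fix X assume "X \<in> ?R"
    then obtain Y where Y: "Y \<subseteq> B - fst ` T" "X = P \<union> Y" by auto
    have "P \<subseteq> B" using TB by (auto simp: P_def)
    moreover have "(b, e) \<in> corner B X" if "(b, e) \<in> T" for b e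
    proof -
      have "b \<notin> Y" using that Y by force
      then show ?thesis
        using that TB Y partial_signs_unique[OF T that, of True] by (cases e) (auto simp: P_def)
    qed
    ultimately show "X \<in> ?L" using Y by auto
  qed
  moreover have "inj_on ((\<union>) P) (Pow (B - fst ` T))"
  proof (rule inj_onI)
    fix Y Z assume "Y \<in> Pow (B - fst ` T)" "Z \<in> Pow (B - fst ` T)" "P \<union> Y = P \<union> Z"
    moreover have "P \<subseteq> fst ` T" by (force simp: P_def)
    ultimately show "Y = Z" by blast
  qed
  ultimately have "card {X \<in> Pow B. T \<subseteq> corner B X} = card (Pow (B - fst ` T))"
    by (simp add: card_image)
  also have "\<dots> = 2 ^ card (B - fst ` T)" using B by (simp add: card_Pow)
  also have "card (B - fst ` T) = card B - card T"
  proof -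
    have "fst ` T \<subseteq> B" using TB by force
    moreover have "card (fst ` T) = card T" using T by (auto simp: partial_signs_def card_image)
    ultimately show ?thesis using B by (simp add: card_Diff_subset finite_subset)
  qed
  finally show ?thesis .
qed

text \<open>Double counting of pairs of a corner and a \<open>k\<close>-subset of its signs in
  \<open>A\<close>: each such subset lies in \<open>2 ^ (card B - k)\<close> corners.\<close>

lemma sum_corners_binomial:
  assumes B: "finite B"
  shows "(\<Sum>X\<in>Pow B. card (corner B X \<inter> A) choose k)
      = 2 ^ (card B - k) * card {T \<in> partial_signs B. T \<subseteq> A \<and> card T = k}"
proof -
  define Q where "Q = {T \<in> partial_signs B. T \<subseteq> A \<and> card T = k}"
  have fin: "finite Q" unfolding Q_def using finite_partial_signs_set[OF B] by simp
  have "(\<Sum>X\<in>Pow B. card (corner B X \<inter> A) choose k) = (\<Sum>X\<in>Pow B. card {T \<in> Q. T \<subseteq> corner B X})"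
  proof (rule sum.cong)
    fix X
    have "{T \<in> Q. T \<subseteq> corner B X} = {T. T \<subseteq> corner B X \<inter> A \<and> card T = k}"
      unfolding Q_def using partial_signs_subset[OF corner_in_partial_signs] by auto
    then show "card (corner B X \<inter> A) choose k = card {T \<in> Q. T \<subseteq> corner B X}"
      using n_subsets[of "corner B X \<inter> A" k] B by simp
  qed simp
  also have "\<dots> = (\<Sum>T\<in>Q. card {X \<in> Pow B. T \<subseteq> corner B X})"
    by (rule sum_multicount_gen) (use B fin in auto)
  also have "\<dots> = (\<Sum>T\<in>Q. 2 ^ (card B - k))"
    by (rule sum.cong) (auto simp: Q_def card_corners_containing[OF B, simplified])
  finally show ?thesis by (simp add: Q_def)
qed

section \<open>Faces of the unit cube\<close>

definition cube_face :: "'a::euclidean_space set \<Rightarrow> ('a \<times> bool) set \<Rightarrow> 'a set"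
  where "cube_face B T = {x \<in> unit_cube B. \<forall>(b, e)\<in>T. x \<bullet> b = of_bool e}"

text \<open>Recovers the signs of a nonempty face. For the empty set every sign is vacuously tight,
  so the empty face is treated separately.\<close>

definition tight_signs :: "'a::euclidean_space set \<Rightarrow> 'a set \<Rightarrow> ('a \<times> bool) set"
  where "tight_signs B F = {(b, e). b \<in> B \<and> (\<forall>x\<in>F. x \<bullet> b = of_bool e)}"

lemma cube_face_inner: "x \<in> cube_face B T \<Longrightarrow> (b, e) \<in> T \<Longrightarrow> x \<bullet> b = of_bool e"
  by (auto simp: cube_face_def)

lemma mem_unit_cube:
  fixes B :: "'a::euclidean_space set"
  assumes "B \<subseteq> Basis"
  shows "x \<in> unit_cube B \<longleftrightarrow>
    (\<forall>b\<in>B. 0 \<le> x \<bullet> b \<and> x \<bullet> b \<le> 1) \<and> (\<forall>b\<in>Basis - B. x \<bullet> b = 0)"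
proof -
  have fin: "finite B" using assms finite_Basis finite_subset by blast
  have "(\<Sum>B) \<bullet> b = (if b \<in> B then 1 else 0)" if "b \<in> Basis" for b
  proof -
    have "(\<Sum>B) \<bullet> b = (\<Sum>c\<in>B. if c = b then 1 else 0)"
      unfolding inner_sum_left by (rule sum.cong) (use that assms in \<open>auto simp: inner_Basis\<close>)
    then show ?thesis using fin by simp
  qed
  then show ?thesis
    using assms by (auto simp: unit_cube_def mem_box)
qed

lemma convex_unit_cube: "convex (unit_cube B)"
  by (simp add: unit_cube_def)

text \<open>0 and 1 are the extreme points of the unit interval. Applied to each fixed coordinate,
  this yields the face property of \<open>cube_face\<close>.\<close>

lemma convex_comb_of_bool:
  fixes a b t :: real
  assumes "0 < t" "t < 1" "0 \<le> a" "a \<le> 1" "0 \<le> b" "b \<le> 1"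
    and "(1 - t) * a + t * b = of_bool e"
  shows "a = of_bool e \<and> b = of_bool e"
proof (cases e)
  case False
  then have "(1 - t) * a = 0 \<and> t * b = 0"
    using assms by (smt (verit) mult_nonneg_nonneg of_bool_eq(1))
  then show ?thesis using False assms by auto
next
  case True
  then have "(1 - t) * (1 - a) + t * (1 - b) = 0" using assms by (simp add: algebra_simps)
  then have "(1 - t) * (1 - a) = 0 \<and> t * (1 - b) = 0"
    using assms by (smt (verit) mult_nonneg_nonneg)
  then show ?thesis using True assms by auto
qed

lemma cube_face_face_of:
  fixes B :: "'a::euclidean_space set"
  assumes B: "B \<subseteq> Basis" and T: "T \<subseteq> B \<times> UNIV"
  shows "cube_face B T face_of unit_cube B"
  unfolding face_of_def
proof (intro conjI ballI impI)
  show "cube_face B T \<subseteq> unit_cube B" by (auto simp: cube_face_def)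
  have "cube_face B T = unit_cube B \<inter> (\<Inter>(b, e)\<in>T. {x. b \<bullet> x = of_bool e})"
    by (auto simp: cube_face_def inner_commute)
  moreover have "convex (\<Inter>(b, e)\<in>T. {x. b \<bullet> x = of_bool e})"
    by (intro convex_INT) (auto intro: convex_hyperplane)
  ultimately show "convex (cube_face B T)" by (simp add: convex_Int convex_unit_cube)
  fix x y z
  assume xy: "x \<in> unit_cube B" "y \<in> unit_cube B" and z: "z \<in> cube_face B T" "z \<in> open_segment x y"
  obtain t where t: "0 < t" "t < 1" "z = (1 - t) *\<^sub>R x + t *\<^sub>R y"
    using z by (auto simp: in_segment)
  have "x \<bullet> b = of_bool e \<and> y \<bullet> b = of_bool e" if be: "(b, e) \<in> T" for b e
  proof (rule convex_comb_of_bool[OF t(1,2)])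
    show "(1 - t) * (x \<bullet> b) + t * (y \<bullet> b) = of_bool e"
      using z(1) be t(3) by (auto simp: cube_face_def inner_add_left)
  qed (use be T xy mem_unit_cube[OF B] in auto)
  then show "x \<in> cube_face B T" "y \<in> cube_face B T" using xy by (auto simp: cube_face_def)
qed

lemma tight_signs_cube_face:
  fixes B :: "'a::euclidean_space set"
  assumes B: "B \<subseteq> Basis" and T: "T \<in> partial_signs B"
  shows "cube_face B T \<noteq> {}" "tight_signs B (cube_face B T) = T"
proof -
  \<comment> \<open>The centre of the face: the value 1/2 on the free coordinates of
    \<open>B\<close> differs from 0 and 1, so no sign outside \<open>T\<close> is tight
    there.\<close>
  define c :: "'a \<Rightarrow> real" where "c b = (if (b, True) \<in> T then 1 else if (b, False) \<in> T then 0 else if b \<in> B then 1/2 else 0)" for b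
  define p where "p = (\<Sum>b\<in>Basis. c b *\<^sub>R b)"
  have p: "p \<bullet> b = c b" if "b \<in> Basis" for b
    using that by (simp add: p_def)
  have TB: "\<And>b e. (b, e) \<in> T \<Longrightarrow> b \<in> B" using T by (auto simp: partial_signs_def)
  have "p \<bullet> b = of_bool e" if "(b, e) \<in> T" for b e
    using that partial_signs_unique[OF T that, of True] TB[OF that] p[of b] subsetD[OF B, of b]
    by (cases e) (auto simp: c_def)
  moreover have "p \<in> unit_cube B"
    unfolding mem_unit_cube[OF B] using p B TB by (auto simp: c_def)
  ultimately have pin: "p \<in> cube_face B T" by (auto simp: cube_face_def)
  then show "cube_face B T \<noteq> {}" by blast
  have "(b, e) \<in> T" if "(b, e) \<in> tight_signs B (cube_face B T)" for b e
  proof -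
    have "c b = of_bool e" "b \<in> B" using that pin p[of b] B by (auto simp: tight_signs_def)
    then show ?thesis by (cases e) (auto simp: c_def split: if_splits)
  qed
  moreover have "T \<subseteq> tight_signs B (cube_face B T)" using TB by (auto simp: tight_signs_def cube_face_def)
  ultimately show "tight_signs B (cube_face B T) = T" by auto
qed

text \<open>A relative interior point \<open>p\<close> of \<open>F\<close> is strict in every sign
  not tight on \<open>F\<close>. A segment from a point \<open>y\<close> of the cube face through
  \<open>p\<close> can therefore be prolonged inside the cube, and the face property puts
  \<open>y\<close> into \<open>F\<close>.\<close>

lemma cube_face_tight_signs:
  fixes B :: "'a::euclidean_space set"
  assumes B: "B \<subseteq> Basis" and F: "F face_of unit_cube B" "F \<noteq> {}"
  shows "tight_signs B F \<in> partial_signs B" "cube_face B (tight_signs B F) = F"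
proof -
  let ?T = "tight_signs B F" let ?G = "cube_face B ?T"
  obtain x0 where "x0 \<in> F" using F(2) by blast
  then have "e = e'" if "(b, e) \<in> ?T" "(b, e') \<in> ?T" for b e e'
    using that unfolding tight_signs_def by (cases e; cases e') auto
  then show ps: "?T \<in> partial_signs B"
    by (auto simp: partial_signs_def tight_signs_def inj_on_def)
  have conv: "convex F" "F \<subseteq> unit_cube B" using F by (auto simp: face_of_imp_convex face_of_imp_subset)
  have FG: "F \<subseteq> ?G" using conv by (auto simp: cube_face_def tight_signs_def)
  obtain p where p: "p \<in> rel_interior F" using F(2) conv rel_interior_eq_empty by blast
  have pF: "p \<in> F" using p rel_interior_subset by blast
  have strict: "p \<bullet> b \<noteq> of_bool e" if b: "b \<in> B" and nt: "(b, e) \<notin> ?T" for b e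
  proof
    assume pe: "p \<bullet> b = of_bool e"
    obtain x where x: "x \<in> F" "x \<bullet> b \<noteq> of_bool e" using b nt by (auto simp: tight_signs_def)
    obtain s where s: "s > 1" "(1 - s) *\<^sub>R x + s *\<^sub>R p \<in> F"
      using p x convex_rel_interior_iff[OF conv(1) F(2)] by blast
    have r: "0 \<le> (1 - s) * (x \<bullet> b) + s * (p \<bullet> b)" "(1 - s) * (x \<bullet> b) + s * (p \<bullet> b) \<le> 1"
      using s(2) conv(2) b mem_unit_cube[OF B, of "(1 - s) *\<^sub>R x + s *\<^sub>R p"] by (auto simp: inner_add_left)
    have xb: "0 \<le> x \<bullet> b" "x \<bullet> b \<le> 1" using x conv b mem_unit_cube[OF B] by auto
    show False
    proof (cases e)
      case False
      have "0 < (s - 1) * (x \<bullet> b)" using False s x xb by (intro mult_pos_pos) auto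
      then show False using r pe False by (simp add: algebra_simps)
    next
      case True
      have "0 < (s - 1) * (1 - x \<bullet> b)" using True s x xb by (intro mult_pos_pos) auto
      then show False using r pe True by (simp add: algebra_simps)
    qed
  qed
  have "?G \<subseteq> F"
  proof
    fix y assume y: "y \<in> ?G"
    have pc: "p \<in> unit_cube B" and yc: "y \<in> unit_cube B" using pF FG y by (auto simp: cube_face_def)
    \<comment> \<open>Tight coordinates agree at \<open>p\<close> and \<open>y\<close> and do not
      move; the others lie strictly inside the unit interval at \<open>p\<close>, which leaves room
      for small \<open>t\<close>.\<close>
    have ev: "\<forall>\<^sub>F t in at_right (0::real). 0 \<le> p \<bullet> b + t * (p \<bullet> b - y \<bullet> b) \<and> p \<bullet> b + t * (p \<bullet> b - y \<bullet> b) \<le> 1"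
      if b: "b \<in> B" for b
    proof (cases "\<exists>e. (b, e) \<in> ?T")
      case True
      then obtain e where "(b, e) \<in> ?T" by blast
      then have "p \<bullet> b = of_bool e" "y \<bullet> b = of_bool e"
        using pF FG y cube_face_inner by blast+
      then show ?thesis by simp
    next
      case False
      then have "p \<bullet> b \<noteq> 0" "p \<bullet> b \<noteq> 1"
        using strict[OF b, of True] strict[OF b, of False] by auto
      then have pb: "0 < p \<bullet> b" "p \<bullet> b < 1"
        using pc b mem_unit_cube[OF B] by (auto simp: less_le)
      have lim: "((\<lambda>t. p \<bullet> b + t * (p \<bullet> b - y \<bullet> b)) \<longlongrightarrow> p \<bullet> b + 0 * (p \<bullet> b - y \<bullet> b)) (at_right 0)"
        by (intro tendsto_intros)
      have "\<forall>\<^sub>F t in at_right 0. 0 < p \<bullet> b + t * (p \<bullet> b - y \<bullet> b)"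
        using order_tendstoD(1)[OF lim, of 0] pb by simp
      moreover have "\<forall>\<^sub>F t in at_right 0. p \<bullet> b + t * (p \<bullet> b - y \<bullet> b) < 1"
        using order_tendstoD(2)[OF lim, of 1] pb by simp
      ultimately show ?thesis by eventually_elim auto
    qed
    have "\<forall>\<^sub>F t in at_right (0::real). \<forall>b\<in>B. 0 \<le> p \<bullet> b + t * (p \<bullet> b - y \<bullet> b) \<and> p \<bullet> b + t * (p \<bullet> b - y \<bullet> b) \<le> 1"
      using ev finite_subset[OF B finite_Basis] by (simp add: eventually_ball_finite_distrib)
    moreover have "\<forall>\<^sub>F t in at_right (0::real). 0 < t" by (simp add: eventually_at_right_less)
    ultimately have "\<forall>\<^sub>F t in at_right (0::real). 0 < t \<and> (\<forall>b\<in>B. 0 \<le> p \<bullet> b + t * (p \<bullet> b - y \<bullet> b) \<and> p \<bullet> b + t * (p \<bullet> b - y \<bullet> b) \<le> 1)"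
      by eventually_elim auto
    then obtain t :: real where t: "0 < t" and
      tb: "\<forall>b\<in>B. 0 \<le> p \<bullet> b + t * (p \<bullet> b - y \<bullet> b) \<and> p \<bullet> b + t * (p \<bullet> b - y \<bullet> b) \<le> 1"
      using eventually_happens[of _ "at_right (0::real)"] by auto
    define q where "q = p + t *\<^sub>R (p - y)"
    have q: "q \<in> unit_cube B"
      using tb pc yc unfolding mem_unit_cube[OF B] q_def by (auto simp: inner_add_left inner_diff_left)
    show "y \<in> F"
    proof (cases "y = p")
      case False
      have "p = (1 - 1 / (1 + t)) *\<^sub>R y + (1 / (1 + t)) *\<^sub>R q"
      proof -
        have "(1 + t) *\<^sub>R p = t *\<^sub>R y + q" by (simp add: q_def algebra_simps)
        then have "p = (1 / (1 + t)) *\<^sub>R (t *\<^sub>R y + q)" using t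
          by (metis add_pos_pos divide_self_if less_irrefl mult.commute scaleR_one scaleR_scaleR times_divide_eq_right zero_less_one mult_1_right)
        moreover have "1 - 1 / (1 + t) = t / (1 + t)" using t by (simp add: field_simps)
        ultimately show ?thesis by (simp add: scaleR_add_right)
      qed
      moreover have "q \<noteq> y"
      proof
        assume "q = y"
        then have "(1 + t) *\<^sub>R (p - y) = 0" by (simp add: q_def algebra_simps)
        then show False using t False by auto
      qed
      ultimately have "p \<in> open_segment y q" using t
        by (subst in_segment) (auto intro!: exI[of _ "1 / (1 + t)"])
      then show ?thesis using face_ofD[OF F(1) _ yc q pF] by blast
    qed (use pF in simp)
  qed
  then show "?G = F" using FG by blast
qed

lemma unit_cube_face_signs:
  fixes B :: "'a::euclidean_space set"
  assumes B: "B \<subseteq> Basis"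
  shows "bij_betw (tight_signs B) {F. F face_of unit_cube B \<and> F \<noteq> {}} (partial_signs B)"
    and "\<lbrakk>F face_of unit_cube B; F \<noteq> {}; G face_of unit_cube B; G \<noteq> {}\<rbrakk>
      \<Longrightarrow> F \<subseteq> G \<longleftrightarrow> tight_signs B G \<subseteq> tight_signs B F"
proof -
  show "bij_betw (tight_signs B) {F. F face_of unit_cube B \<and> F \<noteq> {}} (partial_signs B)"
    by (rule bij_betw_byWitness[where f' = "cube_face B"])
      (use cube_face_tight_signs[OF B] tight_signs_cube_face[OF B] cube_face_face_of[OF B]
        in \<open>auto simp: partial_signs_def\<close>)
  assume FG: "F face_of unit_cube B" "F \<noteq> {}" "G face_of unit_cube B" "G \<noteq> {}"
  show "F \<subseteq> G \<longleftrightarrow> tight_signs B G \<subseteq> tight_signs B F"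
  proof
    show "F \<subseteq> G \<Longrightarrow> tight_signs B G \<subseteq> tight_signs B F" by (auto simp: tight_signs_def)
    assume "tight_signs B G \<subseteq> tight_signs B F"
    then have "cube_face B (tight_signs B F) \<subseteq> cube_face B (tight_signs B G)"
      by (auto simp: cube_face_def)
    then show "F \<subseteq> G" using cube_face_tight_signs[OF B] FG by simp
  qed
qed

lemma combinatorial_cube_signs:
  fixes B :: "'b::euclidean_space set" and Q :: "'a::euclidean_space set"
  assumes B: "B \<subseteq> Basis" and ce: "combinatorially_equivalent Q (unit_cube B)"
  obtains \<tau> where "bij_betw \<tau> {F. F face_of Q \<and> F \<noteq> {}} (partial_signs B)"
    "\<And>F G. \<lbrakk>F face_of Q; F \<noteq> {}; G face_of Q; G \<noteq> {}\<rbrakk> \<Longrightarrow> F \<subseteq> G \<longleftrightarrow> \<tau> G \<subseteq> \<tau> F"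
proof -
  obtain \<phi> where bij: "bij_betw \<phi> (face_lattice Q) (face_lattice (unit_cube B))"
    and ord: "\<And>F G. F face_of Q \<Longrightarrow> G face_of Q \<Longrightarrow> F \<subseteq> G \<longleftrightarrow> \<phi> F \<subseteq> \<phi> G"
    using ce by (auto simp: combinatorially_equivalent_def face_lattice_def)
  \<comment> \<open>The least face goes to the least face, so the equivalence restricts to the
    nonempty faces.\<close>
  have emp: "\<phi> {} = {}"
  proof -
    have "{} \<in> \<phi> ` face_lattice Q" using bij by (simp add: bij_betw_def face_lattice_def)
    then obtain E where "E face_of Q" "\<phi> E = {}" by (auto simp: face_lattice_def)
    then show ?thesis using ord[of "{}" E] by simp
  qed
  have ne: "\<phi> F \<noteq> {}" if "F face_of Q" "F \<noteq> {}" for F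
    using ord[of F "{}"] that emp by auto
  have fo: "\<phi> F face_of unit_cube B" if "F face_of Q" for F
    using bij that by (auto simp: bij_betw_def face_lattice_def)
  have "bij_betw \<phi> (face_lattice Q - {{}}) (face_lattice (unit_cube B) - {{}})"
    using bij_betw_DiffI[OF bij, of "{{}}" "{{}}"] emp by (simp add: face_lattice_def)
  then have "bij_betw \<phi> {F. F face_of Q \<and> F \<noteq> {}} {F. F face_of unit_cube B \<and> F \<noteq> {}}"
    by (simp add: face_lattice_def set_diff_eq)
  then have "bij_betw (tight_signs B \<circ> \<phi>) {F. F face_of Q \<and> F \<noteq> {}} (partial_signs B)"
    using unit_cube_face_signs(1)[OF B] bij_betw_trans by blast
  then show ?thesis
    by (rule that) (use ord unit_cube_face_signs(2)[OF B] fo ne in auto)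
qed

section \<open>Facets of a polytope and generic directions\<close>

text \<open>\<open>P\<close> may have smaller dimension than its space, so \<open>a w\<close> is
  determined only up to vectors orthogonal to the affine hull of \<open>P\<close>. Directions with
  \<open>m + u \<in> affine hull P\<close> make \<open>u \<bullet> a w\<close> independent of that
  choice.\<close>

locale normalized_polytope =
  fixes P :: "'a::euclidean_space set" and m :: 'a and a :: "'a set \<Rightarrow> 'a"
  assumes poly: "polytope P"
    and m: "m \<in> rel_interior P"
    and valid: "w facet_of P \<Longrightarrow> x \<in> P \<Longrightarrow> a w \<bullet> (x - m) \<le> 1"
    and facet_eq: "w facet_of P \<Longrightarrow> w = P \<inter> {x. a w \<bullet> (x - m) = 1}"
begin

lemma mP: "m \<in> P"
  using m rel_interior_subset by blast

lemma polyhP: "polyhedron P"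
  using poly by (rule polytope_imp_polyhedron)

lemma mem_facet: "w facet_of P \<Longrightarrow> x \<in> w \<longleftrightarrow> x \<in> P \<and> a w \<bullet> (x - m) = 1"
  using facet_eq by blast

lemma facet_polytope: "w facet_of P \<Longrightarrow> polytope w"
  using face_of_polytope_polytope poly facet_of_imp_face_of by blast

lemma facet_subset_eq:
  assumes "v facet_of P" "w facet_of P" "v \<subseteq> w" shows "v = w"
proof (rule ccontr)
  assume "v \<noteq> w"
  have "v face_of w" using assms face_of_face facet_of_imp_face_of by blast
  then have "aff_dim v < aff_dim w"
    using face_of_aff_dim_lt \<open>v \<noteq> w\<close> assms facet_polytope polytope_imp_convex by blast
  then show False using assms by (simp add: facet_of_def)
qed

text \<open>\<open>m\<close> lies in the affine hull of \<open>P\<close> but off the hyperplane, so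
  the section has dimension \<open>aff_dim P - 1\<close>. It contains \<open>w\<close>, which has
  the same dimension.\<close>

lemma affine_hull_facet:
  assumes w: "w facet_of P"
  shows "affine hull w = affine hull P \<inter> {x. a w \<bullet> (x - m) = 1}"
proof -
  have eq: "{x. a w \<bullet> (x - m) = 1} = {x. a w \<bullet> x = 1 + a w \<bullet> m}"
    by (auto simp: inner_diff_right)
  let ?A = "affine hull P \<inter> {x. a w \<bullet> (x - m) = 1}"
  have "m \<in> affine hull P" using mP hull_subset by fast
  then have "\<not> affine hull P \<subseteq> {x. a w \<bullet> (x - m) = 1}" by auto
  moreover have sub: "w \<subseteq> ?A" using facet_eq[OF w] hull_subset[of P affine] by blast
  moreover have "w \<noteq> {}" using w by (simp add: facet_of_def)
  ultimately have "aff_dim ?A = aff_dim P - 1"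
    unfolding eq by (subst aff_dim_affine_Int_hyperplane) auto
  then have "aff_dim ?A \<le> aff_dim w" using w by (simp add: facet_of_def)
  then have "affine hull w = affine hull ?A"
    using aff_dim_eq_full_gen[OF sub] aff_dim_subset[OF sub] by simp
  also have "\<dots> = ?A" unfolding eq by (simp add: affine_Int affine_hyperplane)
  finally show ?thesis .
qed

text \<open>A proper face is the intersection of the facets containing it, so some facet contains
  \<open>R\<close> but not \<open>w\<close>. It meets \<open>w\<close> in a proper face of
  \<open>w\<close> containing \<open>R\<close>, which is \<open>R\<close> itself as \<open>R\<close>
  has codimension one in \<open>w\<close>.\<close>

lemma ridge_in_other_facet:
  assumes w: "w facet_of P" and R: "R facet_of w"
  obtains r where "r facet_of P" "r \<noteq> w" "R = r \<inter> w"
proof -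
  have wP: "w face_of P" using w facet_of_imp_face_of by blast
  have RP: "R face_of P" using R wP facet_of_imp_face_of face_of_trans by blast
  have dR: "aff_dim R = aff_dim P - 2" "R \<noteq> {}" using R w by (auto simp: facet_of_def)
  then have "R \<noteq> P" by auto
  then have RI: "R = \<Inter>{F. F facet_of P \<and> R \<subseteq> F}"
    using face_of_polyhedron[OF polyhP RP] dR by blast
  have "R \<noteq> w" using R by auto
  moreover have "R \<subseteq> w" using R facet_of_imp_subset by blast
  ultimately obtain r where r: "r facet_of P" "R \<subseteq> r" "\<not> w \<subseteq> r" using RI by blast
  have fI: "r \<inter> w face_of w"
    using face_of_Int[of r P w] wP r(1) facet_of_imp_face_of face_of_face by blast
  then have "aff_dim (r \<inter> w) < aff_dim w"
    using face_of_aff_dim_lt r(3) facet_polytope[OF w] polytope_imp_convex by blast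
  moreover have "R face_of r \<inter> w"
    using R r(2) \<open>R \<subseteq> w\<close> fI face_of_face[OF fI] facet_of_imp_face_of by blast
  ultimately have "R = r \<inter> w"
    using face_of_aff_dim_lt[of "r \<inter> w" R] fI face_of_imp_convex R
    by (fastforce simp: facet_of_def)
  then show ?thesis using that r by blast
qed

lemma rel_interior_not_in_other_facet:
  assumes "w facet_of P" "r facet_of P" "r \<noteq> w" "q \<in> rel_interior w"
  shows "a r \<bullet> (q - m) < 1"
proof -
  have qw: "q \<in> w" using assms(4) rel_interior_subset by blast
  have "q \<notin> r"
  proof
    assume "q \<in> r"
    then have "w \<subseteq> r"
      using subset_of_face_of[of r P w] assms facet_of_imp_face_of facet_of_imp_subset by blast
    then show False using facet_subset_eq[OF assms(1,2)] assms(3) by simp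
  qed
  then show ?thesis
    using valid[OF assms(2), of q] mem_facet[OF assms(2)] qw mem_facet[OF assms(1)]
    by (auto simp: less_le)
qed

text \<open>Walk from a relative interior point \<open>q\<close> towards \<open>x\<close>. If the
  walk meets the relative frontier at a point \<open>y\<close> no later than \<open>x\<close>, then
  \<open>y\<close> lies on a ridge \<open>r \<inter> w\<close>; the value of \<open>a r\<close> is
  below 1 at \<open>q\<close>, at most 1 at \<open>x\<close> and equal to 1 at \<open>y\<close>,
  which forces \<open>y = x\<close>.\<close>

lemma facet_if_adjacent_inequalities:
  assumes w: "w facet_of P" and x: "x \<in> affine hull w"
    and adj: "\<And>r. r facet_of P \<Longrightarrow> r \<inter> w facet_of w \<Longrightarrow> a r \<bullet> (x - m) \<le> 1"
  shows "x \<in> w"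
proof -
  have wp: "polytope w" by (rule facet_polytope[OF w])
  have "w \<noteq> {}" using w by (simp add: facet_of_def)
  then obtain q where q: "q \<in> rel_interior w"
    using rel_interior_eq_empty wp polytope_imp_convex by blast
  have qw: "q \<in> w" using q rel_interior_subset by blast
  show ?thesis
  proof (cases "x = q")
    case False
    obtain t where t: "0 < t" "q + t *\<^sub>R (x - q) \<in> rel_frontier w"
      "\<And>e. \<lbrakk>0 \<le> e; e < t\<rbrakk> \<Longrightarrow> q + e *\<^sub>R (x - q) \<in> rel_interior w"
      using ray_to_rel_frontier[of w q "x - q"] wp q x False polytope_imp_bounded by auto
    show ?thesis
    proof (cases "1 < t")
      case True
      then show ?thesis using t(3)[of 1] rel_interior_subset by auto
    next
      case t1: False
      define y where "y = q + t *\<^sub>R (x - q)"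
      obtain R where R: "R facet_of w" "y \<in> R"
        using t(2) rel_frontier_of_polyhedron[of w] wp polytope_imp_polyhedron y_def by blast
      obtain r where r: "r facet_of P" "r \<noteq> w" "R = r \<inter> w"
        using ridge_in_other_facet[OF w R(1)] .
      have lt: "a r \<bullet> (q - m) < 1"
        using rel_interior_not_in_other_facet[OF w r(1,2) q] .
      have "a r \<bullet> (y - m) = 1" using R r mem_facet[OF r(1)] by blast
      then have "(1 - t) * (a r \<bullet> (q - m)) + t * (a r \<bullet> (x - m)) = 1"
        unfolding y_def by (simp add: algebra_simps inner_diff_right inner_add_right)
      moreover have "a r \<bullet> (x - m) \<le> 1" using adj r R by blast
      then have "t * (a r \<bullet> (x - m)) \<le> t" using t(1) by simp
      moreover have "(1 - t) * (a r \<bullet> (q - m)) < (1 - t) \<or> t = 1"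
        using lt t1 by auto
      ultimately have "t = 1" by linarith
      then have "x = y" by (simp add: y_def)
      then show ?thesis using R r by blast
    qed
  qed (use qw in simp)
qed

text \<open>Local minimality of a linear functional at the vertex of the polar polytope dual to the
  facet \<open>w\<close>, within the face dual to \<open>G\<close>, implies global minimality there. Moving \<open>g\<close> in the
  direction \<open>-u\<close>, corrected by a multiple of \<open>g - m\<close> so as to stay on the hyperplane of \<open>w\<close>,
  does not leave \<open>w\<close>.\<close>

lemma local_min_imp_min:
  assumes w: "w facet_of P" and G: "G face_of w" "G \<noteq> {}"
    and u: "m + u \<in> affine hull P"
    and loc: "\<And>r. \<lbrakk>r facet_of P; r \<inter> w facet_of w; G \<subseteq> r\<rbrakk> \<Longrightarrow> u \<bullet> a w \<le> u \<bullet> a r"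
    and v: "v facet_of P" "G \<subseteq> v"
  shows "u \<bullet> a w \<le> u \<bullet> a v"
proof -
  have Gw: "G \<subseteq> w" using G face_of_imp_subset by blast
  obtain g where g: "g \<in> rel_interior G"
    using G face_of_imp_convex rel_interior_eq_empty by blast
  have gG: "g \<in> G" using g rel_interior_subset by blast
  then have gw: "g \<in> w" and gP: "g \<in> P" using Gw mem_facet[OF w] by auto
  have G_sub: "G \<subseteq> r" if "r facet_of P" "g \<in> r" for r
    using subset_of_face_of[of r P G] that g Gw facet_of_imp_face_of facet_of_imp_subset[OF w] by blast
  have aw: "a w \<bullet> (g - m) = 1" using gw mem_facet[OF w] by blast
  define z where "z = (u \<bullet> a w) *\<^sub>R (g - m) - u"
  have z: "a r \<bullet> z = (u \<bullet> a w) * (a r \<bullet> (g - m)) - u \<bullet> a r" for r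
    by (simp add: z_def inner_diff_right inner_commute)
  have aff: "g + t *\<^sub>R z \<in> affine hull w" for t
  proof -
    have A: "affine (affine hull P)" by simp
    have "m \<in> affine hull P" "g \<in> affine hull P" using mP gP hull_subset by fast+
    then have "g + (t * (u \<bullet> a w)) *\<^sub>R (g - m) \<in> affine hull P"
      using mem_affine_3_minus[OF A] by blast
    then have "g + (t * (u \<bullet> a w)) *\<^sub>R (g - m) + (- t) *\<^sub>R (m + u - m) \<in> affine hull P"
      using mem_affine_3_minus[OF A] u \<open>m \<in> affine hull P\<close> by blast
    then have "g + t *\<^sub>R z \<in> affine hull P" by (simp add: z_def algebra_simps)
    moreover have "a w \<bullet> (g + t *\<^sub>R z - m) = 1"
      using z[of w] aw by (simp add: inner_diff_right inner_add_right)
    ultimately show ?thesis using affine_hull_facet[OF w] by blast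
  qed
  \<comment> \<open>Facets through \<open>g\<close> contain \<open>G\<close>, so \<open>loc\<close>
    makes \<open>a r\<close> non-increasing along \<open>z\<close>; the others are slack at
    \<open>g\<close> and stay so for small \<open>t\<close>.\<close>
  have ev: "\<forall>\<^sub>F t in at_right (0::real). a r \<bullet> (g + t *\<^sub>R z - m) \<le> 1"
    if r: "r facet_of P" "r \<inter> w facet_of w" for r
  proof (cases "g \<in> r")
    case True
    then have "a r \<bullet> (g - m) = 1" using mem_facet[OF r(1)] by blast
    then have zr: "a r \<bullet> z \<le> 0" using loc[OF r G_sub[OF r(1) True]] z[of r] by simp
    have "a r \<bullet> (g + t *\<^sub>R z - m) \<le> 1" if "0 < t" for t
    proof -
      have "t * (a r \<bullet> z) \<le> 0" using that zr by (simp add: mult_le_0_iff)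
      then show ?thesis using \<open>a r \<bullet> (g - m) = 1\<close> by (simp add: inner_diff_right inner_add_right)
    qed
    then show ?thesis by (rule eventually_mono[OF eventually_at_right_less])
  next
    case False
    then have lt: "a r \<bullet> (g + 0 *\<^sub>R z - m) < 1"
      using valid[OF r(1) gP] mem_facet[OF r(1)] gP by (auto simp: less_le)
    have "((\<lambda>t. a r \<bullet> (g + t *\<^sub>R z - m)) \<longlongrightarrow> a r \<bullet> (g + 0 *\<^sub>R z - m)) (at_right 0)"
      by (intro tendsto_intros)
    from order_tendstoD(2)[OF this lt] show ?thesis by eventually_elim simp
  qed
  have "finite {r. r facet_of P \<and> r \<inter> w facet_of w}"
    using finite_polytope_facets[OF poly] by (rule finite_subset[rotated]) auto
  then have "\<forall>\<^sub>F t in at_right (0::real). \<forall>r\<in>{r. r facet_of P \<and> r \<inter> w facet_of w}. a r \<bullet> (g + t *\<^sub>R z - m) \<le> 1"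
    using ev by (subst eventually_ball_finite_distrib) auto
  moreover have "\<forall>\<^sub>F t in at_right (0::real). 0 < t" by (simp add: eventually_at_right_less)
  ultimately have "\<forall>\<^sub>F t in at_right (0::real). 0 < t \<and> (\<forall>r\<in>{r. r facet_of P \<and> r \<inter> w facet_of w}. a r \<bullet> (g + t *\<^sub>R z - m) \<le> 1)"
    by eventually_elim auto
  then obtain t :: real where t: "0 < t"
    "\<forall>r\<in>{r. r facet_of P \<and> r \<inter> w facet_of w}. a r \<bullet> (g + t *\<^sub>R z - m) \<le> 1"
    using eventually_happens[of _ "at_right (0::real)"] by auto
  have "g + t *\<^sub>R z \<in> w"
    by (rule facet_if_adjacent_inequalities[OF w aff]) (use t in auto)
  then have "a v \<bullet> (g + t *\<^sub>R z - m) \<le> 1" using valid[OF v(1)] mem_facet[OF w] by blast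
  moreover have gv: "a v \<bullet> (g - m) = 1" using gG v mem_facet[OF v(1)] by blast
  ultimately have "t * (a v \<bullet> z) \<le> 0" by (simp add: inner_diff_right inner_add_right)
  then have "a v \<bullet> z \<le> 0" using t by (simp add: mult_le_0_iff)
  then show ?thesis using z[of v] gv by simp
qed

text \<open>The normal of a facet containing \<open>R\<close> takes the value 1 on \<open>R\<close>, so on the affine hull of
  \<open>P\<close> it is determined by its value at one point \<open>q\<close> outside \<open>R\<close>. Hence three such normals are
  collinear, and the middle one would be a proper convex combination of the other two.\<close>

lemma ridge_in_at_most_two_facets_aux:
  assumes w: "w facet_of P" and R: "R facet_of w"
    and r: "r facet_of P" "r \<noteq> w" "R \<subseteq> r"
    and s: "s facet_of P" "s \<noteq> w" "R \<subseteq> s"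
    and q: "q \<in> rel_interior w" and le: "a r \<bullet> (q - m) \<le> a s \<bullet> (q - m)"
  shows "r = s"
proof -
  have qw: "q \<in> w" using q rel_interior_subset by blast
  have Rw: "R \<subseteq> w" using R facet_of_imp_subset by blast
  have lr: "a r \<bullet> (q - m) < 1" and ls: "a s \<bullet> (q - m) < 1"
    using rel_interior_not_in_other_facet w r s q by auto
  have one: "a w \<bullet> (x - m) = 1" "a r \<bullet> (x - m) = 1" "a s \<bullet> (x - m) = 1" if "x \<in> R" for x
    using that Rw r(3) s(3) mem_facet w r(1) s(1) by blast+
  have ext: "c \<bullet> (x - m) = b" if "\<And>y. y \<in> S \<Longrightarrow> c \<bullet> (y - m) = b" "x \<in> affine hull S" for c b S x
  proof -
    have "{x. c \<bullet> (x - m) = b} = {x. c \<bullet> x = b + c \<bullet> m}" by (auto simp: inner_diff_right)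
    then have "affine {x. c \<bullet> (x - m) = b}" by (simp add: affine_hyperplane)
    then have "affine hull S \<subseteq> {x. c \<bullet> (x - m) = b}" using that(1) by (intro hull_minimal) auto
    then show ?thesis using that(2) by blast
  qed
  have "m \<notin> affine hull R" using ext[of R "a w" 1 m] one by auto
  \<comment> \<open>The functional of \<open>a w - a r\<close> vanishes at \<open>m\<close> and on
    \<open>R\<close> but is positive at \<open>q\<close>. Hence \<open>R\<close>, \<open>m\<close>
    and \<open>q\<close> span the affine hull of \<open>P\<close>.\<close>
  moreover have "q \<notin> affine hull (insert m R)"
  proof
    assume "q \<in> affine hull (insert m R)"
    then have "(a w - a r) \<bullet> (q - m) = 0"
      using ext[of "insert m R" "a w - a r" 0 q] one(1,2)
      by (simp add: inner_diff_left) (metis inner_zero_right diff_self)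
    then show False using lr qw mem_facet[OF w] by (simp add: inner_diff_left)
  qed
  ultimately have "aff_dim (insert q (insert m R)) = aff_dim P"
    using R w by (simp add: aff_dim_insert facet_of_def)
  moreover have "insert q (insert m R) \<subseteq> P"
    using qw Rw mP facet_of_imp_subset[OF w] by blast
  ultimately have hull: "affine hull (insert q (insert m R)) = affine hull P"
    by (simp add: aff_dim_eq_full_gen)
  \<comment> \<open>The weight for which \<open>a s\<close> and
    \<open>l *\<^sub>R a w + (1 - l) *\<^sub>R a r\<close> agree at \<open>q\<close>, where
    \<open>a w\<close> has value 1; at \<open>m\<close> and on \<open>R\<close> they agree for every
    weight.\<close>
  define l where "l = (a s \<bullet> (q - m) - a r \<bullet> (q - m)) / (1 - a r \<bullet> (q - m))"
  have l: "0 \<le> l" "l < 1" using lr ls le by (auto simp: l_def field_simps)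
  have lq: "l * (1 - a r \<bullet> (q - m)) = a s \<bullet> (q - m) - a r \<bullet> (q - m)"
    using lr by (simp add: l_def)
  define c where "c = a s - l *\<^sub>R a w - (1 - l) *\<^sub>R a r"
  have c: "c \<bullet> (x - m) = 0" if "x \<in> P" for x
  proof (rule ext)
    show "x \<in> affine hull (insert q (insert m R))" unfolding hull using that by (rule hull_inc)
    fix y assume "y \<in> insert q (insert m R)"
    then consider "y = q" | "y = m" | "y \<in> R" by blast
    then show "c \<bullet> (y - m) = 0"
    proof cases
      case 1
      have "a w \<bullet> (q - m) = 1" using qw mem_facet[OF w] by blast
      then show ?thesis unfolding 1 using lq by (simp add: c_def inner_diff_left algebra_simps)
    next
      case 3
      then show ?thesis using one[OF 3] by (simp add: c_def inner_diff_left)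
    qed simp
  qed
  \<comment> \<open>On \<open>s\<close> the combination equals 1 while each term is at most its
    weight; as \<open>1 - l\<close> is positive, \<open>a r\<close> attains 1.\<close>
  have "s \<subseteq> r"
  proof
    fix x assume x: "x \<in> s"
    then have xP: "x \<in> P" and "a s \<bullet> (x - m) = 1" using mem_facet[OF s(1)] by auto
    then have "l * (a w \<bullet> (x - m)) + (1 - l) * (a r \<bullet> (x - m)) = 1"
      using c[OF xP] by (simp add: c_def inner_diff_left)
    moreover have "l * (a w \<bullet> (x - m)) \<le> l * 1"
      using valid[OF w xP] l by (intro mult_left_mono) auto
    ultimately have "(1 - l) * (a r \<bullet> (x - m)) \<ge> 1 - l" by linarith
    then have "a r \<bullet> (x - m) \<ge> 1" using l by (simp add: mult_le_cancel_left1)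
    then show "x \<in> r" using valid[OF r(1) xP] mem_facet[OF r(1)] xP by auto
  qed
  then show ?thesis using facet_subset_eq s r by metis
qed

lemma ridge_in_at_most_two_facets:
  assumes w: "w facet_of P" and R: "R facet_of w"
    and r: "r facet_of P" "r \<noteq> w" "R \<subseteq> r"
    and s: "s facet_of P" "s \<noteq> w" "R \<subseteq> s"
  shows "r = s"
proof -
  have "w \<noteq> {}" using w by (simp add: facet_of_def)
  then obtain q where q: "q \<in> rel_interior w"
    using rel_interior_eq_empty facet_polytope[OF w] polytope_imp_convex by blast
  show ?thesis
    using ridge_in_at_most_two_facets_aux[OF w R r s q]
      ridge_in_at_most_two_facets_aux[OF w R s r q, symmetric] linear by blast
qed

end

section \<open>Normalized facet inequalities and generic directions\<close>

text \<open>A relative interior point satisfies every facet inequality strictly, so each can be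
  divided by its positive slack at \<open>m\<close>.\<close>

lemma normalized_polytope_exists:
  fixes P :: "'a::euclidean_space set"
  assumes P: "polytope P" "P \<noteq> {}"
  obtains m a where "normalized_polytope P m a"
proof -
  obtain m where m: "m \<in> rel_interior P"
    using P rel_interior_eq_empty polytope_imp_convex by blast
  have "\<exists>c. (\<forall>x\<in>P. c \<bullet> (x - m) \<le> 1) \<and> w = P \<inter> {x. c \<bullet> (x - m) = 1}" if w: "w facet_of P" for w
  proof -
    obtain b \<beta> where b: "P \<subseteq> {x. b \<bullet> x \<le> \<beta>}" "w = P \<inter> {x. b \<bullet> x = \<beta>}"
      using facet_of_polyhedron[OF polytope_imp_polyhedron[OF P(1)] w] by metis
    have "w \<noteq> P" using w by auto
    then have "m \<notin> w"
      using m face_of_disjoint_rel_interior[of w P] facet_of_imp_face_of[OF w] by blast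
    moreover have "m \<in> P" using m rel_interior_subset by blast
    ultimately have pos: "0 < \<beta> - b \<bullet> m" using b by (auto simp: less_le)
    have "(1 / (\<beta> - b \<bullet> m)) *\<^sub>R b \<bullet> (x - m) = (b \<bullet> x - b \<bullet> m) / (\<beta> - b \<bullet> m)" for x
      by (simp add: inner_diff_right diff_divide_distrib)
    then show ?thesis
      using b pos by (intro exI[of _ "(1 / (\<beta> - b \<bullet> m)) *\<^sub>R b"]) (auto simp: field_simps)
  qed
  then obtain a where "\<And>w. w facet_of P \<Longrightarrow> (\<forall>x\<in>P. a w \<bullet> (x - m) \<le> 1) \<and> w = P \<inter> {x. a w \<bullet> (x - m) = 1}"
    by metis
  then have "normalized_polytope P m a" using P m by unfold_locales blast+
  then show ?thesis using that by blast
qed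

text \<open>A vector avoiding the earlier hyperplanes still avoids them after a small perturbation,
  whose direction \<open>v\<close> is chosen off the new hyperplane.\<close>

lemma subspace_avoids_hyperplanes:
  fixes S :: "'a::euclidean_space set"
  assumes "finite D" "subspace S" "\<And>c. c \<in> D \<Longrightarrow> \<exists>v\<in>S. c \<bullet> v \<noteq> 0"
  shows "\<exists>u\<in>S. \<forall>c\<in>D. c \<bullet> u \<noteq> 0"
  using assms
proof (induction D rule: finite_induct)
  case empty
  then show ?case using subspace_0 by blast
next
  case (insert c D)
  obtain u where u: "u \<in> S" "\<forall>e\<in>D. e \<bullet> u \<noteq> 0" using insert by auto
  obtain v where v: "v \<in> S" "c \<bullet> v \<noteq> 0" using insert by auto
  show ?case
  proof (cases "c \<bullet> u = 0")
    case True
    have "\<forall>\<^sub>F t in at_right (0::real). e \<bullet> (u + t *\<^sub>R v) \<noteq> 0" if "e \<in> D" for e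
    proof (rule tendsto_imp_eventually_ne)
      show "((\<lambda>t. e \<bullet> (u + t *\<^sub>R v)) \<longlongrightarrow> e \<bullet> (u + 0 *\<^sub>R v)) (at_right 0)"
        by (intro tendsto_intros)
    qed (use u that in simp)
    then have "\<forall>\<^sub>F t in at_right (0::real). \<forall>e\<in>D. e \<bullet> (u + t *\<^sub>R v) \<noteq> 0"
      using insert by (simp add: eventually_ball_finite_distrib)
    moreover have "\<forall>\<^sub>F t in at_right (0::real). 0 < t" by (simp add: eventually_at_right_less)
    ultimately have "\<forall>\<^sub>F t in at_right (0::real). 0 < t \<and> (\<forall>e\<in>D. e \<bullet> (u + t *\<^sub>R v) \<noteq> 0)"
      by eventually_elim auto
    then obtain t :: real where "0 < t" "\<forall>e\<in>D. e \<bullet> (u + t *\<^sub>R v) \<noteq> 0"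
      using eventually_happens[of _ "at_right (0::real)"] by auto
    moreover have "u + t *\<^sub>R v \<in> S" using insert u v by (simp add: subspace_add subspace_scale)
    moreover have "c \<bullet> (u + t *\<^sub>R v) \<noteq> 0" using True v \<open>0 < t\<close> by (simp add: inner_add_right)
    ultimately show ?thesis by blast
  qed (use u in auto)
qed

lemma (in normalized_polytope) generic_direction:
  obtains u where "m + u \<in> affine hull P" "inj_on (\<lambda>w. u \<bullet> a w) {w. w facet_of P}"
proof -
  define S where "S = (\<lambda>x. x - m) ` (affine hull P)"
  have mA: "m \<in> affine hull P" using mP hull_subset by fast
  then have S: "subspace S" unfolding S_def by (intro affine_diffs_subspace_subtract) auto
  define D where "D = (\<lambda>(v, w). a v - a w) ` {(v, w). v facet_of P \<and> w facet_of P \<and> v \<noteq> w}"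
  have "finite D" unfolding D_def
    using finite_polytope_facets[OF poly]
    by (intro finite_imageI) (rule finite_subset[of _ "{w. w facet_of P} \<times> {w. w facet_of P}"], auto)
  moreover have "\<exists>y\<in>S. c \<bullet> y \<noteq> 0" if c: "c \<in> D" for c
  proof -
    obtain v w where vw: "v facet_of P" "w facet_of P" "v \<noteq> w" "c = a v - a w"
      using c by (auto simp: D_def)
    \<comment> \<open>At a point of \<open>v\<close> outside \<open>w\<close> the first normal has
      value 1 and the second does not, so their difference does not vanish on
      \<open>S\<close>.\<close>
    then obtain x where x: "x \<in> v" "x \<notin> w" using facet_subset_eq[of v w] by blast
    then have "x \<in> P" using mem_facet vw by blast
    then have "x - m \<in> S" unfolding S_def by (intro imageI hull_inc)
    moreover have "c \<bullet> (x - m) \<noteq> 0"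
      using x \<open>x \<in> P\<close> mem_facet[OF vw(1)] mem_facet[OF vw(2)] vw(4) by (simp add: inner_diff_left)
    ultimately show ?thesis by blast
  qed
  ultimately obtain u where u: "u \<in> S" "\<forall>c\<in>D. c \<bullet> u \<noteq> 0"
    using subspace_avoids_hyperplanes[OF _ S] by blast
  show ?thesis
  proof
    show "m + u \<in> affine hull P" using u(1) by (auto simp: S_def)
    show "inj_on (\<lambda>w. u \<bullet> a w) {w. w facet_of P}"
    proof (rule inj_onI, rule ccontr)
      fix v w assume "v \<in> {w. w facet_of P}" "w \<in> {w. w facet_of P}" "u \<bullet> a v = u \<bullet> a w" "v \<noteq> w"
      then have "a v - a w \<in> D" "(a v - a w) \<bullet> u = 0"
        by (force simp: D_def, simp add: inner_commute[of _ u] inner_diff_right)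
      then show False using u(2) by blast
    qed
  qed
qed

section \<open>Counting faces by their minimal facet\<close>

locale cube_coordinates =
  fixes Q :: "'a::euclidean_space set" and B :: "'b set" and \<tau> :: "'a set \<Rightarrow> ('b \<times> bool) set"
  assumes polyQ: "polytope Q" and finB: "finite B" and dimQ: "aff_dim Q = int (card B)"
    and bij: "bij_betw \<tau> {F. F face_of Q \<and> F \<noteq> {}} (partial_signs B)"
    and anti: "\<lbrakk>F face_of Q; F \<noteq> {}; G face_of Q; G \<noteq> {}\<rbrakk> \<Longrightarrow> F \<subseteq> G \<longleftrightarrow> \<tau> G \<subseteq> \<tau> F"
begin

lemma signs_in: "F face_of Q \<Longrightarrow> F \<noteq> {} \<Longrightarrow> \<tau> F \<in> partial_signs B"
  using bij by (auto simp: bij_betw_def)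

lemma signs_eq_iff:
  "\<lbrakk>F face_of Q; F \<noteq> {}; G face_of Q; G \<noteq> {}\<rbrakk> \<Longrightarrow> \<tau> F = \<tau> G \<longleftrightarrow> F = G"
  using anti by blast

lemma face_with_signs:
  assumes "T \<in> partial_signs B"
  obtains F where "F face_of Q" "F \<noteq> {}" "\<tau> F = T"
proof -
  have "T \<in> \<tau> ` {F. F face_of Q \<and> F \<noteq> {}}" using assms bij by (simp add: bij_betw_def)
  then show ?thesis using that by blast
qed

lemma Q_face: "Q face_of Q" "Q \<noteq> {}"
  using polyQ polytope_imp_convex face_of_refl dimQ by auto

lemma signs_Q: "\<tau> Q = {}"
proof -
  obtain F where F: "F face_of Q" "F \<noteq> {}" "\<tau> F = {}"
    using face_with_signs[of "{}"] by (auto simp: partial_signs_def)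
  then show ?thesis using anti[OF F(1,2) Q_face] face_of_imp_subset[OF F(1)] by simp
qed

text \<open>Induction on the number of signs. If \<open>G\<close> has the signs of \<open>F\<close>
  without \<open>t\<close>, a facet \<open>K\<close> of \<open>G\<close> through \<open>F\<close>
  has strictly more signs than \<open>G\<close> and none outside those of \<open>F\<close>, so
  \<open>K = F\<close> and the dimension drops by exactly one.\<close>

lemma face_dim:
  assumes "F face_of Q" "F \<noteq> {}"
  shows "aff_dim F + int (card (\<tau> F)) = int (card B)"
  using assms
proof (induction "card (\<tau> F)" arbitrary: F)
  case 0
  then have "\<tau> F = {}" using finite_partial_signs[OF finB signs_in] by force
  then have "F = Q" using signs_eq_iff[OF 0(2,3) Q_face] signs_Q by simp
  then show ?case using dimQ signs_Q by simp
next
  case (Suc k)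
  then have "\<tau> F \<noteq> {}" by auto
  then obtain t where t: "t \<in> \<tau> F" by blast
  have fin: "finite (\<tau> F)" using finite_partial_signs[OF finB signs_in] Suc by blast
  obtain G where G: "G face_of Q" "G \<noteq> {}" "\<tau> G = \<tau> F - {t}"
    using face_with_signs[of "\<tau> F - {t}"] partial_signs_subset[OF signs_in[OF Suc(3,4)]] by blast
  have cG: "card (\<tau> G) = k" using G t fin Suc(2) by simp
  have FG: "F \<subseteq> G" "F \<noteq> G" using anti[OF Suc(3,4) G(1,2)] G(3) t by auto
  have "F face_of G" using FG Suc(3) G(1) face_of_face by blast
  moreover have polyG: "polytope G" using G(1) polyQ face_of_polytope_polytope by blast
  ultimately obtain K where K: "K facet_of G" "F \<subseteq> K"
    using face_of_polyhedron_subset_facet[of G F] Suc(4) FG(2) polytope_imp_polyhedron by blast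
  have KQ: "K face_of Q" "K \<noteq> {}" "K \<subseteq> G" "K \<noteq> G"
    using K(1) G(1) face_of_trans by (auto simp: facet_of_def face_of_imp_subset)
  have "\<tau> G \<subseteq> \<tau> K" "\<tau> K \<subseteq> \<tau> F" "\<tau> G \<noteq> \<tau> K"
    using anti KQ G(1,2) K(2) Suc(3,4) signs_eq_iff by metis+
  then have "\<tau> K = \<tau> F" using G(3) by blast
  then have "K = F" using signs_eq_iff KQ Suc by blast
  then have "aff_dim F = aff_dim G - 1" using K(1) by (simp add: facet_of_def)
  moreover have "aff_dim G + int (card (\<tau> G)) = int (card B)" using Suc(1) cG G by blast
  ultimately show ?case using cG Suc(2) by simp
qed

lemma facet_iff: "R facet_of Q \<longleftrightarrow> R face_of Q \<and> R \<noteq> {} \<and> (\<exists>t. \<tau> R = {t})"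
proof -
  have "aff_dim R = aff_dim Q - 1 \<longleftrightarrow> card (\<tau> R) = 1" if "R face_of Q" "R \<noteq> {}"
    using face_dim[OF that] dimQ by auto
  then show ?thesis by (auto simp: facet_of_def card_1_singleton_iff)
qed

lemma facet_with_sign:
  assumes "t \<in> B \<times> UNIV"
  obtains R where "R facet_of Q" "\<tau> R = {t}"
proof -
  have "{t} \<in> partial_signs B" using assms by (auto simp: partial_signs_def)
  then obtain R where "R face_of Q" "R \<noteq> {}" "\<tau> R = {t}" using face_with_signs by blast
  then show ?thesis using that facet_iff by blast
qed

end

section \<open>Ascending ridges and lowest facets\<close>

locale cubical_polytope_coordinates = normalized_polytope P m a
  for P :: "'a::euclidean_space set" and m a +
  fixes n :: nat and B :: "'a set \<Rightarrow> 'b set" and \<tau> :: "'a set \<Rightarrow> 'a set \<Rightarrow> ('b \<times> bool) set"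
  assumes dimP: "aff_dim P = int n + 1"
    and cardB: "w facet_of P \<Longrightarrow> card (B w) = n"
    and coords: "w facet_of P \<Longrightarrow> cube_coordinates w (B w) (\<tau> w)"
begin

abbreviation facets :: "'a set set" where "facets \<equiv> {w. w facet_of P}"

text \<open>A sign \<open>t\<close> names a ridge of \<open>w\<close>. Exactly one other facet meets
  \<open>w\<close> in that ridge, so the universal quantifier selects that neighbour. Two opposite
  ridges may both ascend, so the result need not be a partial sign set.\<close>

definition ascending :: "'a \<Rightarrow> 'a set \<Rightarrow> ('b \<times> bool) set" where
  "ascending u w = {t \<in> B w \<times> UNIV.
     \<forall>r. r facet_of P \<and> r \<noteq> w \<and> r \<inter> w facet_of w \<and> \<tau> w (r \<inter> w) = {t} \<longrightarrow> u \<bullet> a w < u \<bullet> a r}"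

text \<open>Each sign has a single neighbour, whose value differs from that of \<open>w\<close> by
  injectivity; reversing the direction reverses the strict inequality.\<close>

lemma ascending_uminus:
  assumes w: "w facet_of P" and inj: "inj_on (\<lambda>w. u \<bullet> a w) facets"
  shows "ascending (- u) w = B w \<times> UNIV - ascending u w"
proof -
  interpret cube_coordinates w "B w" "\<tau> w" using coords[OF w] .
  have "t \<in> ascending (- u) w \<longleftrightarrow> t \<notin> ascending u w" if t: "t \<in> B w \<times> UNIV" for t
  proof -
    obtain R where R: "R facet_of w" "\<tau> w R = {t}" using facet_with_sign[OF t] .
    obtain r where r: "r facet_of P" "r \<noteq> w" "R = r \<inter> w" using ridge_in_other_facet[OF w R(1)] .
    have "s = r" if s: "s facet_of P" "s \<noteq> w" "s \<inter> w facet_of w" "\<tau> w (s \<inter> w) = {t}" for s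
    proof -
      have "s \<inter> w = R" using signs_eq_iff R s(3,4) facet_iff by metis
      then show ?thesis using ridge_in_at_most_two_facets[OF w R(1)] r s by blast
    qed
    then have "\<And>v. t \<in> ascending v w \<longleftrightarrow> v \<bullet> a w < v \<bullet> a r"
      unfolding ascending_def using r R t by blast
    moreover have "u \<bullet> a w \<noteq> u \<bullet> a r" using inj w r by (auto dest: inj_onD)
    ultimately show ?thesis by auto
  qed
  then show ?thesis by (auto simp: ascending_def)
qed

text \<open>The signs of \<open>G\<close> are those of the ridges of \<open>w\<close> through
  \<open>G\<close>. Minimality across these ridges becomes global by
  \<open>local_min_imp_min\<close>; conversely, injectivity makes the minimum strict.\<close>

lemma signs_subset_ascending_iff:
  assumes w: "w facet_of P" and G: "G face_of w" "G \<noteq> {}"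
    and u: "m + u \<in> affine hull P" and inj: "inj_on (\<lambda>w. u \<bullet> a w) facets"
  shows "\<tau> w G \<subseteq> ascending u w \<longleftrightarrow> (\<forall>r. r facet_of P \<and> G \<subseteq> r \<longrightarrow> u \<bullet> a w \<le> u \<bullet> a r)"
proof -
  interpret cube_coordinates w "B w" "\<tau> w" using coords[OF w] .
  have Gw: "G \<subseteq> w" using G face_of_imp_subset by blast
  show ?thesis
  proof
    assume sub: "\<tau> w G \<subseteq> ascending u w"
    show "\<forall>r. r facet_of P \<and> G \<subseteq> r \<longrightarrow> u \<bullet> a w \<le> u \<bullet> a r"
    proof (intro allI impI, elim conjE)
      fix v assume v: "v facet_of P" "G \<subseteq> v"
      show "u \<bullet> a w \<le> u \<bullet> a v"
      proof (rule local_min_imp_min[OF w G u _ v])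
        fix r assume r: "r facet_of P" "r \<inter> w facet_of w" "G \<subseteq> r"
        then obtain t where t: "\<tau> w (r \<inter> w) = {t}" "r \<inter> w face_of w" "r \<inter> w \<noteq> {}"
          using facet_iff by blast
        have "G \<subseteq> r \<inter> w" using r Gw by blast
        then have "t \<in> \<tau> w G" using anti[OF G t(2,3)] t(1) by blast
        moreover have "r \<noteq> w" using r by auto
        ultimately show "u \<bullet> a w \<le> u \<bullet> a r"
          using sub r t unfolding ascending_def by (blast intro: less_imp_le)
      qed
    qed
  next
    assume min: "\<forall>r. r facet_of P \<and> G \<subseteq> r \<longrightarrow> u \<bullet> a w \<le> u \<bullet> a r"
    show "\<tau> w G \<subseteq> ascending u w"
    proof
      fix t assume t: "t \<in> \<tau> w G"
      then have "t \<in> B w \<times> UNIV" using signs_in[OF G] by (auto simp: partial_signs_def)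
      moreover have "u \<bullet> a w < u \<bullet> a r"
        if r: "r facet_of P" "r \<noteq> w" "r \<inter> w facet_of w" "\<tau> w (r \<inter> w) = {t}" for r
      proof -
        have "G \<subseteq> r \<inter> w" using anti[OF G, of "r \<inter> w"] r facet_iff t by auto
        then have "u \<bullet> a w \<le> u \<bullet> a r" using min r by blast
        moreover have "u \<bullet> a w \<noteq> u \<bullet> a r" using inj w r by (auto dest: inj_onD)
        ultimately show ?thesis by simp
      qed
      ultimately show "t \<in> ascending u w" unfolding ascending_def by blast
    qed
  qed
qed

text \<open>The contribution of \<open>w\<close> in \<open>face_number_eq_sum\<close>: faces of
  dimension \<open>n - k\<close> with lowest facet \<open>w\<close>, encoded by signs.\<close>

definition signs_count :: "'a \<Rightarrow> nat \<Rightarrow> 'a set \<Rightarrow> nat" where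
  "signs_count u k w = card {T \<in> partial_signs (B w). T \<subseteq> ascending u w \<and> card T = k}"

lemma finite_facets: "finite facets"
  using finite_polytope_facets[OF poly] .

lemma face_number_eq_sum:
  assumes k: "k \<le> n"
    and u: "m + u \<in> affine hull P" and inj: "inj_on (\<lambda>w. u \<bullet> a w) facets"
  shows "face_number P (n - k) = (\<Sum>w\<in>facets. signs_count u k w)"
proof -
  \<comment> \<open>Faces sorted by their lowest facet, which is unique by injectivity, so the
    classes are disjoint.\<close>
  define M where "M w = {G. G face_of w \<and> aff_dim G = int (n - k) \<and>
      (\<forall>r. r facet_of P \<and> G \<subseteq> r \<longrightarrow> u \<bullet> a w \<le> u \<bullet> a r)}" for w
  have "{G. G face_of P \<and> aff_dim G = int (n - k)} = (\<Union>w\<in>facets. M w)"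
  proof (intro subset_antisym subsetI)
    fix G assume "G \<in> {G. G face_of P \<and> aff_dim G = int (n - k)}"
    then have G: "G face_of P" "aff_dim G = int (n - k)" by auto
    \<comment> \<open>The dimension of \<open>G\<close> lies between 0 and \<open>n\<close>, below
      that of \<open>P\<close>, so \<open>G\<close> is a nonempty proper face and some facet
      contains it.\<close>
    have ne: "G \<noteq> {}" "G \<noteq> P" using G(2) dimP by auto
    let ?W = "{w. w facet_of P \<and> G \<subseteq> w}"
    have "finite ?W" "?W \<noteq> {}"
      using finite_facets face_of_polyhedron_subset_facet[OF polyhP G(1) ne] by auto
    then obtain w where w: "w \<in> ?W" "\<And>r. r \<in> ?W \<Longrightarrow> u \<bullet> a w \<le> u \<bullet> a r"
      using ex_is_arg_min_if_finite[of ?W "\<lambda>w. u \<bullet> a w"] by (auto simp: is_arg_min_linorder)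
    moreover have "G face_of w"
      using w(1) G(1) face_of_subset facet_of_imp_subset by blast
    ultimately show "G \<in> (\<Union>w\<in>facets. M w)" using G(2) by (auto simp: M_def)
  next
    fix G assume "G \<in> (\<Union>w\<in>facets. M w)"
    then show "G \<in> {G. G face_of P \<and> aff_dim G = int (n - k)}"
      unfolding M_def using facet_of_imp_face_of face_of_trans by blast
  qed
  then have "face_number P (n - k) = card (\<Union>w\<in>facets. M w)" by (simp add: face_number_def)
  also have "\<dots> = (\<Sum>w\<in>facets. card (M w))"
  proof (rule card_UN_disjoint[OF finite_facets])
    show "\<forall>w\<in>facets. finite (M w)"
      using finite_polytope_faces[OF facet_polytope] by (auto simp: M_def)
    show "\<forall>v\<in>facets. \<forall>w\<in>facets. v \<noteq> w \<longrightarrow> M v \<inter> M w = {}"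
    proof (intro ballI impI, rule ccontr)
      fix v w assume vw: "v \<in> facets" "w \<in> facets" "v \<noteq> w" "M v \<inter> M w \<noteq> {}"
      then obtain G where "G \<in> M v" "G \<in> M w" by blast
      moreover from this have "G \<subseteq> v" "G \<subseteq> w" unfolding M_def using face_of_imp_subset by blast+
      ultimately have "u \<bullet> a v \<le> u \<bullet> a w" "u \<bullet> a w \<le> u \<bullet> a v"
        using vw(1,2) unfolding M_def by blast+
      then show False using inj_onD[OF inj, of v w] vw by simp
    qed
  qed
  also have "\<dots> = (\<Sum>w\<in>facets. signs_count u k w)"
  proof (rule sum.cong)
    fix w assume "w \<in> facets"
    then have w: "w facet_of P" by simp
    interpret cube_coordinates w "B w" "\<tau> w" using coords[OF w] .
    have M: "G \<in> M w \<longleftrightarrow> G face_of w \<and> G \<noteq> {} \<and> \<tau> w G \<subseteq> ascending u w \<and> card (\<tau> w G) = k" for G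
    proof (cases "G face_of w \<and> G \<noteq> {}")
      case True
      then have "aff_dim G = int (n - k) \<longleftrightarrow> card (\<tau> w G) = k"
        using face_dim[of G] cardB[OF w] k by auto
      then show ?thesis using True signs_subset_ascending_iff[OF w _ _ u inj, of G] by (auto simp: M_def)
    qed (auto simp: M_def)
    have "bij_betw (\<tau> w) (M w) {T \<in> partial_signs (B w). T \<subseteq> ascending u w \<and> card T = k}"
      unfolding bij_betw_def
    proof
      show "inj_on (\<tau> w) (M w)" using signs_eq_iff M by (auto intro!: inj_onI)
      show "\<tau> w ` M w = {T \<in> partial_signs (B w). T \<subseteq> ascending u w \<and> card T = k}"
      proof (intro subset_antisym subsetI)
        fix T assume T: "T \<in> {T \<in> partial_signs (B w). T \<subseteq> ascending u w \<and> card T = k}"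
        then obtain G where "G face_of w" "G \<noteq> {}" "\<tau> w G = T" using face_with_signs by blast
        then show "T \<in> \<tau> w ` M w" using T M by blast
      qed (use M signs_in in auto)
    qed
    then show "card (M w) = signs_count u k w"
      unfolding signs_count_def by (rule bij_betw_same_card)
  qed simp
  finally show ?thesis .
qed

section \<open>Comparing face numbers through sums over corners\<close>

text \<open>The factor \<open>2 ^ (n - k)\<close> makes the index set of the sum independent of
  \<open>k\<close>, so neighbouring face numbers can be compared term by term.\<close>

lemma face_number_eq_corner_sum:
  assumes "k \<le> n" "m + u \<in> affine hull P" "inj_on (\<lambda>w. u \<bullet> a w) facets"
  shows "2 ^ (n - k) * face_number P (n - k)
    = (\<Sum>w\<in>facets. \<Sum>X\<in>Pow (B w). card (corner (B w) X \<inter> ascending u w) choose k)"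
proof -
  have "2 ^ (n - k) * signs_count u k w
      = (\<Sum>X\<in>Pow (B w). card (corner (B w) X \<inter> ascending u w) choose k)" if "w \<in> facets" for w
    using sum_corners_binomial[of "B w" "ascending u w" k] cardB coords[THEN cube_coordinates.finB] that
    by (simp add: signs_count_def)
  then show ?thesis by (simp add: face_number_eq_sum[OF assms] sum_distrib_left)
qed

text \<open>The sums for \<open>u\<close> and \<open>- u\<close> count the same faces; a corner has
  \<open>n\<close> signs, so its number of ascending ridges turns from \<open>p\<close> into
  \<open>n - p\<close>.\<close>

lemma face_number_eq_paired_sum:
  assumes k: "k \<le> n" and u: "m + u \<in> affine hull P" and inj: "inj_on (\<lambda>w. u \<bullet> a w) facets"
  shows "2 * 2 ^ (n - k) * face_number P (n - k)
    = (\<Sum>w\<in>facets. \<Sum>X\<in>Pow (B w). (card (corner (B w) X \<inter> ascending u w) choose k)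
        + ((n - card (corner (B w) X \<inter> ascending u w)) choose k))"
proof -
  have mA: "m \<in> affine hull P" using mP by (rule hull_inc)
  have "m + (-1) *\<^sub>R (m + u - m) \<in> affine hull P"
    by (rule mem_affine_3_minus[OF affine_affine_hull mA u mA])
  then have u': "m + (- u) \<in> affine hull P" by simp
  have inj': "inj_on (\<lambda>w. (- u) \<bullet> a w) facets" using inj by (auto simp: inj_on_def)
  have "card (corner (B w) X \<inter> ascending (- u) w) = n - card (corner (B w) X \<inter> ascending u w)"
    if w: "w \<in> facets" for w X
  proof -
    have fin: "finite (B w)" using w coords cube_coordinates.finB by blast
    have "corner (B w) X \<inter> ascending (- u) w = corner (B w) X - (corner (B w) X \<inter> ascending u w)"
      using ascending_uminus[of w u] w inj by (auto simp: corner_def)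
    then show ?thesis using fin w cardB by (simp add: card_Diff_subset card_corner)
  qed
  then have "2 ^ (n - k) * face_number P (n - k)
    = (\<Sum>w\<in>facets. \<Sum>X\<in>Pow (B w). (n - card (corner (B w) X \<inter> ascending u w)) choose k)"
    unfolding face_number_eq_corner_sum[OF k u' inj'] by simp
  then show ?thesis
    using face_number_eq_corner_sum[OF k u inj] by (simp add: sum.distrib)
qed

lemma facets_nonempty: "facets \<noteq> {}"
proof -
  have "0 < aff_dim P" using dimP by simp
  then show ?thesis using polytope_facet_exists[OF poly] by blast
qed

lemma card_corner_ascending_le:
  assumes "w \<in> facets" shows "card (corner (B w) X \<inter> ascending u w) \<le> n"
proof -
  have "finite (B w)" using assms coords cube_coordinates.finB by blast
  then show ?thesis using card_mono[of "corner (B w) X" "corner (B w) X \<inter> ascending u w"] assms cardB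
    by (simp add: card_corner)
qed

text \<open>A single term can fail the comparison when few ridges ascend, but \<open>p\<close> and
  \<open>n - p\<close> add up to \<open>n\<close>, so \<open>binomial_pair_less\<close> applies to
  each pair.\<close>

lemma upper_faces_decreasing:
  assumes j: "3 * j + 3 \<le> n"
  shows "face_number P (n - j) < face_number P (n - Suc j)"
proof -
  obtain u where u: "m + u \<in> affine hull P" "inj_on (\<lambda>w. u \<bullet> a w) facets"
    using generic_direction .
  define p where "p w X = card (corner (B w) X \<inter> ascending u w)" for w X
  define S where "S k = (\<Sum>w\<in>facets. \<Sum>X\<in>Pow (B w). (p w X choose k) + ((n - p w X) choose k))" for k
  have "S j < (\<Sum>w\<in>facets. \<Sum>X\<in>Pow (B w). 2 * (p w X choose Suc j) + 2 * ((n - p w X) choose Suc j))"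
    unfolding S_def
  proof (intro sum_strict_mono finite_facets facets_nonempty)
    fix w X assume w: "w \<in> facets"
    then show "finite (Pow (B w))" using coords cube_coordinates.finB by blast
    show "Pow (B w) \<noteq> {}" by blast
    show "(p w X choose j) + ((n - p w X) choose j) < 2 * (p w X choose Suc j) + 2 * ((n - p w X) choose Suc j)"
      using card_corner_ascending_le[OF w] j by (intro binomial_pair_less) (simp add: p_def)
  qed
  also have "\<dots> = 2 * S (Suc j)" by (simp add: S_def sum_distrib_left)
  finally have "S j < 2 * S (Suc j)" .
  moreover have "S k = 2 * 2 ^ (n - k) * face_number P (n - k)" if "k \<le> n" for k
    unfolding S_def p_def using face_number_eq_paired_sum[OF that u] by simp
  ultimately have "2 * 2 ^ (n - j) * face_number P (n - j) < 2 * (2 * 2 ^ (n - Suc j) * face_number P (n - Suc j))"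
    using j by simp
  \<comment> \<open>The factor 2 of the termwise comparison cancels the ratio of the two
    powers.\<close>
  moreover have "(2::nat) * 2 ^ (n - Suc j) = 2 ^ (n - j)" using j
    by (simp flip: power_Suc add: Suc_diff_Suc)
  ultimately show ?thesis by simp
qed

lemma lower_faces_increasing:
  assumes j: "2 * n \<le> 3 * j + 1" "Suc j \<le> n"
  shows "face_number P (n - Suc j) \<le> face_number P (n - j)"
    and "2 * n < 3 * j + 1 \<Longrightarrow> face_number P (n - Suc j) < face_number P (n - j)"
proof -
  obtain u where u: "m + u \<in> affine hull P" "inj_on (\<lambda>w. u \<bullet> a w) facets"
    using generic_direction .
  define p where "p w X = card (corner (B w) X \<inter> ascending u w)" for w X
  define S where "S k = (\<Sum>w\<in>facets. \<Sum>X\<in>Pow (B w). p w X choose k)" for k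
  have Sk: "S k = 2 ^ (n - k) * face_number P (n - k)" if "k \<le> n" for k
    unfolding S_def p_def using face_number_eq_corner_sum[OF that u] by simp
  have pow: "(2::nat) ^ (n - j) = 2 * 2 ^ (n - Suc j)" using j
    by (simp flip: power_Suc add: Suc_diff_Suc)
  have S2: "2 * S (Suc j) = 2 ^ (n - j) * face_number P (n - Suc j)" "S j = 2 ^ (n - j) * face_number P (n - j)"
    using Sk[of "Suc j"] Sk[of j] j pow by auto
  have S2': "2 * S (Suc j) = (\<Sum>w\<in>facets. \<Sum>X\<in>Pow (B w). 2 * (p w X choose Suc j))"
    by (simp add: S_def sum_distrib_left)
  have le: "2 * (p w X choose Suc j) \<le> p w X choose j" if "w \<in> facets" for w X
    using two_binomial_Suc_le[OF j(1)] card_corner_ascending_le[OF that] by (simp add: p_def)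
  have "2 * S (Suc j) \<le> S j"
    unfolding S2' unfolding S_def by (intro sum_mono le)
  then show "face_number P (n - Suc j) \<le> face_number P (n - j)" using S2 by simp
  assume strict: "2 * n < 3 * j + 1"
  \<comment> \<open>All ridges of the globally lowest facet ascend, so \<open>p = n\<close> at each
    of its corners and \<open>two_binomial_Suc_less\<close> gives strict terms.\<close>
  obtain w where w: "w \<in> facets" "\<And>r. r \<in> facets \<Longrightarrow> u \<bullet> a w \<le> u \<bullet> a r"
    using ex_is_arg_min_if_finite[OF finite_facets facets_nonempty, of "\<lambda>w. u \<bullet> a w"]
    by (auto simp: is_arg_min_linorder)
  have fw: "finite (B w)" using w coords cube_coordinates.finB by blast
  have "u \<bullet> a w < u \<bullet> a r" if "r \<in> facets" "r \<noteq> w" for r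
    using w(2)[OF that(1)] inj_onD[OF u(2), of w r] w(1) that by force
  then have "ascending u w = B w \<times> UNIV" by (auto simp: ascending_def)
  then have "corner (B w) X \<inter> ascending u w = corner (B w) X" for X by (auto simp: corner_def)
  then have pn: "p w X = n" for X using w(1) cardB by (simp add: p_def card_corner)
  have "2 * S (Suc j) < S j"
    unfolding S2' unfolding S_def
  proof (rule sum_strict_mono_ex1[OF finite_facets])
    show "\<forall>w\<in>facets. (\<Sum>X\<in>Pow (B w). 2 * (p w X choose Suc j)) \<le> (\<Sum>X\<in>Pow (B w). p w X choose j)"
      by (intro ballI sum_mono le)
    have "(\<Sum>X\<in>Pow (B w). 2 * (p w X choose Suc j)) < (\<Sum>X\<in>Pow (B w). p w X choose j)"
      unfolding pn using fw two_binomial_Suc_less[OF strict] j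
      by (intro sum_strict_mono) auto
    then show "\<exists>w\<in>facets. (\<Sum>X\<in>Pow (B w). 2 * (p w X choose Suc j)) < (\<Sum>X\<in>Pow (B w). p w X choose j)"
      using w(1) by blast
  qed
  then show "face_number P (n - Suc j) < face_number P (n - j)" using S2 by simp
qed

end

section \<open>Coordinates on a cubical polytope and the final index translation\<close>

lemma cubical_polytope_coordinates_exist:
  fixes P :: "'a::euclidean_space set"
  assumes P: "cubical_polytope d P" and d: "1 \<le> d"
  obtains m a and B :: "'a set \<Rightarrow> 'a set" and \<tau>
  where "cubical_polytope_coordinates P m a (d - 1) B \<tau>"
proof -
  have poly: "polytope P" and dim: "aff_dim P = int d" using P by (auto simp: cubical_polytope_def)
  have "P \<noteq> {}" using dim by auto
  then obtain m a where "normalized_polytope P m a" using normalized_polytope_exists[OF poly] by blast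
  then interpret normalized_polytope P m a .
  have "\<exists>(B :: 'a set) \<tau>. card B = d - 1 \<and> cube_coordinates w B \<tau>" if w: "w facet_of P" for w
  proof -
    obtain B where B: "B \<subseteq> (Basis :: 'a set)" "card B = d - 1" "combinatorially_equivalent w (unit_cube B)"
      using P w by (auto simp: cubical_polytope_def)
    obtain \<tau> where \<tau>: "bij_betw \<tau> {F. F face_of w \<and> F \<noteq> {}} (partial_signs B)"
      "\<And>F G. \<lbrakk>F face_of w; F \<noteq> {}; G face_of w; G \<noteq> {}\<rbrakk> \<Longrightarrow> F \<subseteq> G \<longleftrightarrow> \<tau> G \<subseteq> \<tau> F"
      by (rule combinatorial_cube_signs[OF B(1,3)]) (use that in blast)
    have "cube_coordinates w B \<tau>"
    proof
      show "finite B" using B(1) finite_Basis finite_subset by blast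
      show "aff_dim w = int (card B)" using w dim d B(2) by (simp add: facet_of_def)
    qed (use \<tau> facet_polytope[OF w] in auto)
    then show ?thesis using B(2) by blast
  qed
  then obtain B :: "'a set \<Rightarrow> 'a set" and \<tau>
    where "\<And>w. w facet_of P \<Longrightarrow> card (B w) = d - 1 \<and> cube_coordinates w (B w) (\<tau> w)"
    by metis
  then have "cubical_polytope_coordinates P m a (d - 1) B \<tau>"
    using dim d
    by (intro cubical_polytope_coordinates.intro[OF normalized_polytope_axioms]
        cubical_polytope_coordinates_axioms.intro) auto
  then show ?thesis using that by blast
qed

theorem theorem1:
  fixes P :: "'a::euclidean_space set" and d :: nat
  assumes "cubical_polytope d P"
  shows "(\<forall>i. i + 1 < d div 3 \<longrightarrow> face_number P i < face_number P (i + 1)) \<and>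
         (1 \<le> d div 3 \<longrightarrow> face_number P (d div 3 - 1) \<le> face_number P (d div 3)) \<and>
         (\<forall>i. (2 * d) div 3 \<le> i \<and> i + 1 \<le> d - 1 \<longrightarrow>
              face_number P i > face_number P (i + 1))"
proof (cases "1 \<le> d")
  case True
  then obtain m a and B :: "'a set \<Rightarrow> 'a set" and \<tau>
    where "cubical_polytope_coordinates P m a (d - 1) B \<tau>"
    using cubical_polytope_coordinates_exist[OF assms] by metis
  then interpret cubical_polytope_coordinates P m a "d - 1" B \<tau> .
  \<comment> \<open>With \<open>n = d - 1\<close> and \<open>j = d - 2 - i\<close>, the dimensions
    \<open>n - Suc j\<close> and \<open>n - j\<close> are \<open>i\<close> and \<open>i + 1\<close>,
    and \<open>2 * n \<le> 3 * j + 1\<close> becomes \<open>3 * (i + 1) \<le> d\<close>.\<close>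
  have lower: "face_number P i \<le> face_number P (i + 1)" if "3 * (i + 1) \<le> d" for i
  proof -
    have "d - 1 - Suc (d - 2 - i) = i" "d - 1 - (d - 2 - i) = i + 1" using that by auto
    then show ?thesis using lower_faces_increasing(1)[of "d - 2 - i"] that by simp
  qed
  \<comment> \<open>\<open>i + 1 < d div 3\<close> implies this strict bound; for
    \<open>i + 1 = d div 3\<close> equality \<open>3 * (i + 1) = d\<close> can occur, hence the weak
    last inequality.\<close>
  have strict: "face_number P i < face_number P (i + 1)" if "3 * (i + 1) < d" for i
  proof -
    have "d - 1 - Suc (d - 2 - i) = i" "d - 1 - (d - 2 - i) = i + 1" using that by auto
    then show ?thesis using lower_faces_increasing(2)[of "d - 2 - i"] that by simp
  qed
  have upper: "face_number P (i + 1) < face_number P i" if "(2 * d) div 3 \<le> i" "i + 1 \<le> d - 1" for i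
  proof -
    have "d - 1 - Suc (d - 2 - i) = i" "d - 1 - (d - 2 - i) = i + 1" using that by auto
    \<comment> \<open>\<open>(2 * d) div 3 \<le> i\<close> amounts to
      \<open>2 * d \<le> 3 * i + 2\<close>, a rearrangement of this bound.\<close>
    moreover have "3 * (d - 2 - i) + 3 \<le> d - 1" using that by auto
    ultimately show ?thesis using upper_faces_decreasing[of "d - 2 - i"] by simp
  qed
  have "face_number P (d div 3 - 1) \<le> face_number P (d div 3)" if "1 \<le> d div 3"
    using lower[of "d div 3 - 1"] that by simp
  then show ?thesis using strict upper by auto
\<comment> \<open>For \<open>d = 0\<close> every range in the statement is empty.\<close>
qed auto

end
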